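(* For $p>2$, the function $L_\alpha$ is strictly convex on $[z_p,1)$.
   Context: $p=\alpha(\alpha+1)$, $\alpha>0$; $L_\alpha$ is the solution on $(-1,1)$ of $(1-x^2)y''-2xy'+py=0$ bounded near $1$ with $L_\alpha(1)=1$, and $z_p$ is its largest zero in $(-1,1)$. *)

theory Defs
  imports "HOL-Analysis.Analysis"
begin

definition legendre_sol :: "real \<Rightarrow> (real \<Rightarrow> real) \<Rightarrow> bool" where
  "legendre_sol \<alpha> y \<longleftrightarrow>
     (\<forall>x\<in>{-1<..<1}.
        (y has_real_derivative deriv y x) (at x) \<and>
        (deriv y has_real_derivative deriv (deriv y) x) (at x) \<and>
        (1 - x\<^sup>2) * deriv (deriv y) x - 2 * x * deriv y x + \<alpha> * (\<alpha> + 1) * y x = 0) \<and>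
     (\<exists>\<delta>>0. \<exists>B. \<forall>x\<in>{1-\<delta><..<1}. \<bar>y x\<bar> \<le> B) \<and>
     (y \<longlongrightarrow> 1) (at_left 1) \<and> y 1 = 1"

text \<open>L_alpha, the (unique) such solution, considered on (-1,1].\<close>
definition Leg :: "real \<Rightarrow> real \<Rightarrow> real" where
  "Leg \<alpha> x = (THE v. \<exists>y. legendre_sol \<alpha> y \<and> y x = v)"

definition zp :: "real \<Rightarrow> real" where
  "zp \<alpha> = (GREATEST x. x \<in> {-1<..<1} \<and> Leg \<alpha> x = 0)"

definition strict_convex_on :: "real set \<Rightarrow> (real \<Rightarrow> real) \<Rightarrow> bool" where
  "strict_convex_on S f \<longleftrightarrow>
     (\<forall>x\<in>S. \<forall>y\<in>S. \<forall>t::real. x \<noteq> y \<and> 0 < t \<and> t < 1 \<longrightarrow>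
        f ((1 - t) * x + t * y) < (1 - t) * f x + t * f y)"

end

theory Submission
  imports Defs
begin

text \<open>
  The proof works with an explicit regular solution L of
  (1 - x^2) y'' - 2 x y' + p y = 0: in the variable t = (1 - x)/2 the equation becomes the
  hypergeometric equation t (1 - t) w'' + (1 - 2t) w' + p w = 0, whose power series with
  coefficients c_(n+1) = c_n (n(n+1) - p)/(n+1)^2, c_0 = 1, converges for |t| < 1.  This gives
  a smooth solution on (-1,3) with L(1) = 1 (locale regular_legendre).

  Uniqueness identifies L with the frozen Leg: a solution bounded near 1 has vanishing
  Wronskian with L (a nonzero Wronskian would make y/L grow like log(1/(1-x))), hence agrees
  with L near 1, and then everywhere on (-1,1] by an energy estimate for the difference.

  The convexity itself comes from two monotone quantities.  The flux (1 - x^2) L' has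
  derivative -p L, so it is positive wherever L is positive up to 1; this makes L' > 0 on
  (z_p, 1) and also forces L to have a zero in (-1,1).  The second flux
  (1 - x^2)(2x L' - p L) = (1 - x^2)^2 L'' has derivative (2 - p)(1 - x^2) L', which is
  negative there when p > 2, so L'' > 0 on (z_p, 1).  A differentiable function with
  strictly increasing derivative is strictly convex, which gives the theorem.
\<close>

fun hg_coeff :: "real \<Rightarrow> nat \<Rightarrow> real" where
  "hg_coeff p 0 = 1"
| "hg_coeff p (Suc n) = hg_coeff p n * (real n * (real n + 1) - p) / (real n + 1)^2"

declare hg_coeff.simps(2)[simp del]

lemma hg_coeff_recurrence:
  "(real n + 1)^2 * hg_coeff p (Suc n) = (real n * (real n + 1) - p) * hg_coeff p n"
  by (simp add: hg_coeff.simps(2))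

text \<open>For n \<ge> p the recurrence factor lies in [0,1], so the coefficients are bounded.\<close>
lemma hg_coeff_bounded:
  assumes "0 \<le> p" shows "\<exists>M. \<forall>n. \<bar>hg_coeff p n\<bar> \<le> M"
proof -
  obtain N :: nat where N: "p \<le> real N" using real_arch_simple by blast
  define M where "M = (\<Sum>k\<le>N. \<bar>hg_coeff p k\<bar>)"
  have "\<bar>hg_coeff p n\<bar> \<le> M" for n
  proof (induction n)
    case 0
    show ?case unfolding M_def by (rule member_le_sum) auto
  next
    case (Suc n)
    show ?case
    proof (cases "Suc n \<le> N")
      case True
      then show ?thesis unfolding M_def by (intro member_le_sum) auto
    next
      case False
      have "real N \<le> real n" using False by simp
      moreover have "real n \<le> real n * (real n + 1)" by (simp add: algebra_simps)
      ultimately have lo: "0 \<le> real n * (real n + 1) - p" using N by linarith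
      have hi: "real n * (real n + 1) - p \<le> (real n + 1)^2"
        using assms by (simp add: power2_eq_square algebra_simps)
      have "\<bar>hg_coeff p (Suc n)\<bar> = \<bar>hg_coeff p n\<bar> * ((real n * (real n + 1) - p) / (real n + 1)^2)"
        using lo by (simp add: abs_mult hg_coeff.simps(2))
      also have "\<dots> \<le> \<bar>hg_coeff p n\<bar>"
        using lo hi by (intro mult_left_le) (auto simp: divide_le_eq_1)
      finally show ?thesis using Suc.IH by simp
    qed
  qed
  thus ?thesis by blast
qed

lemma hg_summable:
  assumes "0 \<le> p" "\<bar>t\<bar> < 1" shows "summable (\<lambda>n. hg_coeff p n * t^n)"
proof -
  obtain M where M: "\<And>n. \<bar>hg_coeff p n\<bar> \<le> M" using hg_coeff_bounded[OF assms(1)] by blast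
  show ?thesis
  proof (rule summable_comparison_test)
    show "\<exists>N. \<forall>n\<ge>N. norm (hg_coeff p n * t^n) \<le> M * \<bar>t\<bar>^n"
      using M by (auto simp: abs_mult power_abs intro!: mult_right_mono)
    show "summable (\<lambda>n. M * \<bar>t\<bar>^n)"
      using assms by (intro summable_mult summable_geometric) auto
  qed
qed

lemma hg_summable':
  assumes "0 \<le> p" "\<bar>t\<bar> < 1" shows "summable (\<lambda>n. diffs (hg_coeff p) n * t^n)"
  by (rule termdiff_converges[where K=1]) (use assms hg_summable in auto)

lemma hg_summable'':
  assumes "0 \<le> p" "\<bar>t\<bar> < 1" shows "summable (\<lambda>n. diffs (diffs (hg_coeff p)) n * t^n)"
  by (rule termdiff_converges[where K=1]) (use assms hg_summable' in auto)

definition hg :: "real \<Rightarrow> real \<Rightarrow> real" where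
  "hg p t = (\<Sum>n. hg_coeff p n * t^n)"

definition hg' :: "real \<Rightarrow> real \<Rightarrow> real" where
  "hg' p t = (\<Sum>n. diffs (hg_coeff p) n * t^n)"

definition hg'' :: "real \<Rightarrow> real \<Rightarrow> real" where
  "hg'' p t = (\<Sum>n. diffs (diffs (hg_coeff p)) n * t^n)"

lemma hg_deriv:
  assumes "0 \<le> p" "\<bar>t\<bar> < 1" shows "(hg p has_real_derivative hg' p t) (at t)"
  unfolding hg_def hg'_def
  by (rule termdiffs_strong'[where K=1]) (use assms hg_summable in auto)

lemma hg'_deriv:
  assumes "0 \<le> p" "\<bar>t\<bar> < 1" shows "(hg' p has_real_derivative hg'' p t) (at t)"
  unfolding hg'_def hg''_def
  by (rule termdiffs_strong'[where K=1]) (use assms hg_summable' in auto)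

lemma sums_times_variable:
  fixes a :: "nat \<Rightarrow> real"
  assumes "(\<lambda>n. a (Suc n) * t^n) sums s" "a 0 = 0"
  shows "(\<lambda>n. a n * t^n) sums (t * s)"
proof -
  have "(\<lambda>n. a (Suc n) * t^Suc n) sums (t * s)"
    using sums_mult[OF assms(1), of t] by (simp add: algebra_simps)
  thus ?thesis using assms(2) by (subst (asm) sums_Suc_iff) simp
qed

text \<open>The series solves the hypergeometric equation: after shifting indices, the coefficient of t^n
  is exactly the recurrence defining hg_coeff.\<close>
lemma hg_ode:
  assumes "0 \<le> p" "\<bar>t\<bar> < 1"
  shows "t * (1 - t) * hg'' p t + (1 - 2*t) * hg' p t + p * hg p t = 0"
proof -
  let ?c = "hg_coeff p"
  have A: "(\<lambda>n. ?c n * t^n) sums hg p t"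
    unfolding hg_def using hg_summable[OF assms] by (rule summable_sums)
  have B: "(\<lambda>n. (real n + 1) * ?c (Suc n) * t^n) sums hg' p t"
    unfolding hg'_def using summable_sums[OF hg_summable'[OF assms]]
    by (simp add: diffs_def add.commute)
  have C: "(\<lambda>n. (real n + 1) * (real n + 2) * ?c (Suc (Suc n)) * t^n) sums hg'' p t"
    unfolding hg''_def using summable_sums[OF hg_summable''[OF assms]]
    by (simp add: diffs_def algebra_simps)
  have tB: "(\<lambda>n. real n * ?c n * t^n) sums (t * hg' p t)"
    using sums_times_variable[of "\<lambda>n. real n * ?c n"] B by (simp add: algebra_simps)
  have tC: "(\<lambda>n. real n * (real n + 1) * ?c (Suc n) * t^n) sums (t * hg'' p t)"
    using sums_times_variable[of "\<lambda>n. real n * (real n + 1) * ?c (Suc n)"] C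
    by (simp add: algebra_simps)
  have ttC: "(\<lambda>n. (real n - 1) * real n * ?c n * t^n) sums (t * (t * hg'' p t))"
    using sums_times_variable[of "\<lambda>n. (real n - 1) * real n * ?c n"] tC
    by (simp add: algebra_simps)
  have "(\<lambda>n. (real n * (real n + 1) * ?c (Suc n) * t^n - (real n - 1) * real n * ?c n * t^n)
       + ((real n + 1) * ?c (Suc n) * t^n - 2 * (real n * ?c n * t^n)) + p * (?c n * t^n))
      sums ((t * hg'' p t - t * (t * hg'' p t)) + (hg' p t - 2 * (t * hg' p t)) + p * hg p t)"
    by (intro sums_add sums_diff sums_mult A B tB tC ttC)
  moreover have "(real n * (real n + 1) * ?c (Suc n) * t^n - (real n - 1) * real n * ?c n * t^n)
       + ((real n + 1) * ?c (Suc n) * t^n - 2 * (real n * ?c n * t^n)) + p * (?c n * t^n)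
     = t^n * ((real n + 1)^2 * ?c (Suc n) - (real n * (real n + 1) - p) * ?c n)" for n
    by (simp add: algebra_simps power2_eq_square)
  ultimately have zero_sums: "(\<lambda>n. 0) sums ((t * hg'' p t - t * (t * hg'' p t))
      + (hg' p t - 2 * (t * hg' p t)) + p * hg p t)"
    by (simp add: hg_coeff_recurrence)
  have "(t * hg'' p t - t * (t * hg'' p t)) + (hg' p t - 2 * (t * hg' p t)) + p * hg p t = 0"
    using sums_unique2[OF sums_zero zero_sums] by simp
  thus ?thesis by (simp add: algebra_simps)
qed

text \<open>A function whose derivative is at least k/(1-x) with k > 0 grows like k log(1/(1-x)) and is
  therefore unbounded near 1.\<close>
lemma unbounded_if_deriv_ge_log_rate:
  fixes h h' :: "real \<Rightarrow> real"
  assumes "a < 1" and "0 < k"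
    and deriv: "\<And>x. a < x \<Longrightarrow> x < 1 \<Longrightarrow> (h has_real_derivative h' x) (at x)"
    and lower: "\<And>x. a < x \<Longrightarrow> x < 1 \<Longrightarrow> k / (1 - x) \<le> h' x"
  shows "\<exists>x. a < x \<and> x < 1 \<and> M < h x"
proof -
  define g where "g u = h u + k * ln (1 - u)" for u
  have g_deriv: "(g has_real_derivative h' u - k / (1 - u)) (at u)" if "a < u" "u < 1" for u
    unfolding g_def[abs_def] using that
    by (auto intro!: derivative_eq_intros deriv simp: field_simps)
  define x0 where "x0 = (a + 1) / 2"
  have x0: "a < x0" "x0 < 1" using \<open>a < 1\<close> by (auto simp: x0_def)
  have g_mono: "g x0 \<le> g x" if "x0 \<le> x" "x < 1" for x
  proof (rule DERIV_nonneg_imp_increasing_open[OF \<open>x0 \<le> x\<close>])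
    show "\<exists>y. (g has_real_derivative y) (at u) \<and> 0 \<le> y" if "x0 < u" "u < x" for u
      using g_deriv[of u] lower[of u] that x0 \<open>x < 1\<close> by force
    show "continuous_on {x0..x} g"
      by (rule DERIV_continuous_on, rule has_field_derivative_at_within, rule g_deriv)
        (use x0 that in auto)
  qed
  define E where "E = min (ln (1 - x0) - 1) ((g x0 - M) / k - 1)"
  define x where "x = 1 - exp E"
  have "exp E < exp (ln (1 - x0))" by (simp add: E_def)
  hence x: "x0 < x" "x < 1" using x0 by (simp_all add: x_def)
  have "k * E \<le> k * ((g x0 - M) / k - 1)"
    using \<open>0 < k\<close> by (intro mult_left_mono) (auto simp: E_def)
  also have "\<dots> = g x0 - M - k" using \<open>0 < k\<close> by (simp add: field_simps)
  finally have "M + k \<le> g x0 - k * E" by simp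
  also have "\<dots> \<le> h x"
    using g_mono[OF _ x(2)] x by (simp add: g_def x_def)
  finally show ?thesis using x x0 \<open>0 < k\<close> by (intro exI[of _ x]) auto
qed

definition legendre_ode_on ::
    "real \<Rightarrow> real set \<Rightarrow> (real \<Rightarrow> real) \<Rightarrow> (real \<Rightarrow> real) \<Rightarrow> (real \<Rightarrow> real) \<Rightarrow> bool" where
  "legendre_ode_on p S y y' y'' \<longleftrightarrow>
     (\<forall>x\<in>S. (y has_real_derivative y' x) (at x) \<and> (y' has_real_derivative y'' x) (at x) \<and>
        (1 - x\<^sup>2) * y'' x - 2 * x * y' x + p * y x = 0)"

lemma legendre_ode_onD:
  assumes "legendre_ode_on p S y y' y''" "x \<in> S"
  shows "(y has_real_derivative y' x) (at x)" "(y' has_real_derivative y'' x) (at x)"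
    and "(1 - x\<^sup>2) * y'' x = 2 * x * y' x - p * y x"
  using assms unfolding legendre_ode_on_def by auto

lemma legendre_ode_on_diff:
  assumes "legendre_ode_on p S y y' y''" "legendre_ode_on p S z z' z''"
  shows "legendre_ode_on p S (\<lambda>x. y x - z x) (\<lambda>x. y' x - z' x) (\<lambda>x. y'' x - z'' x)"
  unfolding legendre_ode_on_def
proof (intro ballI conjI)
  fix x assume x: "x \<in> S"
  note dy = legendre_ode_onD[OF assms(1) x] and dz = legendre_ode_onD[OF assms(2) x]
  show "((\<lambda>x. y x - z x) has_real_derivative y' x - z' x) (at x)"
    and "((\<lambda>x. y' x - z' x) has_real_derivative y'' x - z'' x) (at x)"
    using dy dz by (auto intro: derivative_intros)
  have "(1 - x\<^sup>2) * (y'' x - z'' x) - 2 * x * (y' x - z' x) + p * (y x - z x)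
      = ((1 - x\<^sup>2) * y'' x - 2 * x * y' x + p * y x) - ((1 - x\<^sup>2) * z'' x - 2 * x * z' x + p * z x)"
    by (simp add: algebra_simps)
  thus "(1 - x\<^sup>2) * (y'' x - z'' x) - 2 * x * (y' x - z' x) + p * (y x - z x) = 0"
    using dy(3) dz(3) by simp
qed

lemma legendre_solD:
  assumes "legendre_sol \<alpha> y"
  shows "\<exists>\<delta>>0. \<exists>B. \<forall>x\<in>{1-\<delta><..<1}. \<bar>y x\<bar> \<le> B"
    and "(y \<longlongrightarrow> 1) (at_left 1)" and "y 1 = 1"
  using assms unfolding legendre_sol_def by blast+

lemma legendre_sol_ode:
  assumes "legendre_sol \<alpha> y"
  shows "legendre_ode_on (\<alpha> * (\<alpha> + 1)) {-1<..<1} y (deriv y) (deriv (deriv y))"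
  using assms unfolding legendre_sol_def legendre_ode_on_def by auto

lemma legendre_wronskian_constant:
  assumes y: "legendre_ode_on p {-1<..<1} y y' y''" and z: "legendre_ode_on p {-1<..<1} z z' z''"
  shows "\<exists>c. \<forall>x\<in>{-1<..<1}. (1 - x\<^sup>2) * (y x * z' x - y' x * z x) = c"
proof (rule has_field_derivative_zero_constant)
  fix x :: real assume x: "x \<in> {-1<..<1}"
  note dy = legendre_ode_onD[OF y x] and dz = legendre_ode_onD[OF z x]
  have "((\<lambda>x. (1 - x\<^sup>2) * (y x * z' x - y' x * z x)) has_real_derivative
      - (2 * x) * (y x * z' x - y' x * z x) + y x * ((1 - x\<^sup>2) * z'' x) - ((1 - x\<^sup>2) * y'' x) * z x) (at x)"
    by (rule derivative_eq_intros dy dz refl | simp add: algebra_simps power2_eq_square)+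
  also have "- (2 * x) * (y x * z' x - y' x * z x) + y x * ((1 - x\<^sup>2) * z'' x) - ((1 - x\<^sup>2) * y'' x) * z x = 0"
    unfolding dy(3) dz(3) by (simp add: algebra_simps)
  finally show "((\<lambda>x. (1 - x\<^sup>2) * (y x * z' x - y' x * z x)) has_real_derivative 0)
      (at x within {-1<..<1})" by (rule has_field_derivative_at_within)
qed simp

lemma legendre_energy_deriv:
  assumes "legendre_ode_on p S d d' d''" "x \<in> S"
  shows "((\<lambda>t. p * (d t)\<^sup>2 + (1 - t\<^sup>2) * (d' t)\<^sup>2) has_real_derivative 2 * x * (d' x)\<^sup>2) (at x)"
proof -
  note dd = legendre_ode_onD[OF assms]
  have "((\<lambda>t. p * (d t)\<^sup>2 + (1 - t\<^sup>2) * (d' t)\<^sup>2) has_real_derivative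
      2 * p * d x * d' x - 2 * x * (d' x)\<^sup>2 + 2 * d' x * ((1 - x\<^sup>2) * d'' x)) (at x)"
    by (rule derivative_eq_intros dd refl | simp add: algebra_simps power2_eq_square)+
  also have "2 * p * d x * d' x - 2 * x * (d' x)\<^sup>2 + 2 * d' x * ((1 - x\<^sup>2) * d'' x) = 2 * x * (d' x)\<^sup>2"
    unfolding dd(3) by (simp add: algebra_simps power2_eq_square)
  finally show ?thesis .
qed

lemma square_less_1_if_in_interval: "x \<in> {-1<..<1} \<Longrightarrow> (x::real)\<^sup>2 < 1"
  by (simp add: abs_square_less_1 abs_less_iff)

lemma one_minus_square_le: "1 - x\<^sup>2 \<le> 2 * (1 - (x::real))"
  using zero_le_power2[of "x - 1"] by (simp add: power2_eq_square algebra_simps)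

lemma square_le_max_square:
  fixes t x c :: real
  assumes "x \<le> t" "t \<le> c"
  shows "t\<^sup>2 \<le> max (x\<^sup>2) (c\<^sup>2)"
proof (cases "0 \<le> t")
  case True
  thus ?thesis using power_mono[OF \<open>t \<le> c\<close>, of 2] by simp
next
  case False
  hence "(- t)\<^sup>2 \<le> (- x)\<^sup>2" using assms by (intro power_mono) auto
  thus ?thesis by simp
qed

text \<open>Backward uniqueness: a solution vanishing with its derivative at c vanishes on (-1,c].
  Away from the singular points the energy, weighted by exp(K x), is nondecreasing.\<close>
lemma legendre_ode_backward_unique:
  assumes d: "legendre_ode_on p {-1<..<1} d d' d''" and "0 < p"
    and x: "-1 < x" "x \<le> c" and "c < 1" and "d c = 0" "d' c = 0"
  shows "d x = 0"
proof -
  define F where "F t = p * (d t)\<^sup>2 + (1 - t\<^sup>2) * (d' t)\<^sup>2" for t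
  define m where "m = min (1 - x\<^sup>2) (1 - c\<^sup>2)"
  have "x\<^sup>2 < 1" "c\<^sup>2 < 1" using x \<open>c < 1\<close> by (auto intro: square_less_1_if_in_interval)
  hence "0 < m" by (simp add: m_def)
  have m_le: "m \<le> 1 - t\<^sup>2" if "x \<le> t" "t \<le> c" for t
    using square_le_max_square[OF that] by (auto simp: m_def)
  define K where "K = 2 / m"
  define G where "G t = exp (K * t) * F t" for t
  have G_deriv: "(G has_real_derivative exp (K * t) * (K * F t + 2 * t * (d' t)\<^sup>2)) (at t)"
    if "t \<in> {-1<..<1}" for t
    unfolding G_def[abs_def] F_def[abs_def]
    by (rule derivative_eq_intros legendre_energy_deriv[OF d that] refl | simp add: algebra_simps)+
  have "G x \<le> G c"
  proof (rule DERIV_nonneg_imp_increasing_open[OF \<open>x \<le> c\<close>])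
    fix t assume t: "x < t" "t < c"
    hence t1: "t \<in> {-1<..<1}" using x \<open>c < 1\<close> by auto
    have "2 * (d' t)\<^sup>2 = K * (m * (d' t)\<^sup>2)" using \<open>0 < m\<close> by (simp add: K_def)
    also have "\<dots> \<le> K * ((1 - t\<^sup>2) * (d' t)\<^sup>2)"
      using m_le[of t] t \<open>0 < m\<close> by (intro mult_left_mono mult_right_mono) (auto simp: K_def)
    also have "\<dots> \<le> K * F t"
      using \<open>0 < m\<close> \<open>0 < p\<close> by (intro mult_left_mono) (auto simp: K_def F_def)
    finally have "0 \<le> K * F t + 2 * t * (d' t)\<^sup>2"
      using mult_right_mono[of "-1" t "(d' t)\<^sup>2"] t1 by simp
    thus "\<exists>y. (G has_real_derivative y) (at t) \<and> 0 \<le> y" using G_deriv[OF t1] by auto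
  next
    show "continuous_on {x..c} G"
      by (rule DERIV_continuous_on, rule has_field_derivative_at_within, rule G_deriv)
        (use x \<open>c < 1\<close> in auto)
  qed
  also have "G c = 0" using \<open>d c = 0\<close> \<open>d' c = 0\<close> by (simp add: G_def F_def)
  finally have "F x \<le> 0" by (simp add: G_def mult_le_0_iff)
  moreover have "0 \<le> (1 - x\<^sup>2) * (d' x)\<^sup>2" using \<open>x\<^sup>2 < 1\<close> by simp
  ultimately have "p * (d x)\<^sup>2 \<le> 0" by (simp add: F_def)
  thus "d x = 0" using \<open>0 < p\<close> by (simp add: mult_le_0_iff)
qed

text \<open>On a convex set, a function with strictly increasing derivative is strictly convex
  (two mean value theorem applications around the convex combination).\<close>
lemma strict_convex_on_if_deriv_strict_mono:
  fixes f f' :: "real \<Rightarrow> real"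
  assumes "convex C"
    and deriv: "\<And>x. x \<in> C \<Longrightarrow> (f has_real_derivative f' x) (at x)"
    and mono: "strict_mono_on C f'"
  shows "strict_convex_on C f"
proof -
  have below_chord: "f ((1 - t) * u + t * v) < (1 - t) * f u + t * f v"
    if uv: "u \<in> C" "v \<in> C" "u < v" and t: "0 < t" "t < 1" for u v t
  proof -
    define z where "z = (1 - t) * u + t * v"
    have zu: "z - u = t * (v - u)" and vz: "v - z = (1 - t) * (v - u)"
      by (simp_all add: z_def algebra_simps)
    have "0 < t * (v - u)" "0 < (1 - t) * (v - u)" using uv t by simp_all
    hence z: "u < z" "z < v" unfolding zu[symmetric] vz[symmetric] by simp_all
    have segment: "{u..v} \<subseteq> C" by (rule atMostAtLeast_subset_convex) fact+
    have deriv_uv: "(f has_real_derivative f' x) (at x)" if "u \<le> x" "x \<le> v" for x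
      using deriv segment that by auto
    obtain \<xi>1 where \<xi>1: "u < \<xi>1" "\<xi>1 < z" "f z - f u = (z - u) * f' \<xi>1"
      using MVT2[OF \<open>u < z\<close> deriv_uv] z by auto
    obtain \<xi>2 where \<xi>2: "z < \<xi>2" "\<xi>2 < v" "f v - f z = (v - z) * f' \<xi>2"
      using MVT2[OF \<open>z < v\<close> deriv_uv] z by auto
    have "f' \<xi>1 < f' \<xi>2"
      using \<xi>1 \<xi>2 segment by (intro strict_mono_onD[OF mono]) auto
    hence "0 < t * (1 - t) * (v - u) * (f' \<xi>2 - f' \<xi>1)" using t uv by (intro mult_pos_pos) auto
    also have "\<dots> = t * (f v - f z) - (1 - t) * (f z - f u)"
      unfolding \<xi>1(3) \<xi>2(3) zu vz by (simp add: algebra_simps)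
    finally show ?thesis unfolding z_def by (simp add: algebra_simps)
  qed
  show ?thesis unfolding strict_convex_on_def
  proof (intro ballI allI impI)
    fix x y t :: real assume xy: "x \<in> C" "y \<in> C" and t: "x \<noteq> y \<and> 0 < t \<and> t < 1"
    show "f ((1 - t) * x + t * y) < (1 - t) * f x + t * f y"
    proof (cases "x < y")
      case True thus ?thesis using below_chord xy t by blast
    next
      case False
      hence "f ((1 - (1 - t)) * y + (1 - t) * x) < (1 - (1 - t)) * f y + (1 - t) * f x"
        using below_chord[of y x "1 - t"] xy t by auto
      thus ?thesis by (simp add: algebra_simps)
    qed
  qed
qed

locale regular_legendre =
  fixes \<alpha> p :: real and L L' L'' :: "real \<Rightarrow> real"
  assumes p_def: "p = \<alpha> * (\<alpha> + 1)" and p_pos: "0 < p"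
    and L_deriv: "\<And>x. x \<in> {-1<..<3} \<Longrightarrow> (L has_real_derivative L' x) (at x)"
    and L'_deriv: "\<And>x. x \<in> {-1<..<3} \<Longrightarrow> (L' has_real_derivative L'' x) (at x)"
    and L_ode: "\<And>x. x \<in> {-1<..<1} \<Longrightarrow> (1 - x\<^sup>2) * L'' x - 2 * x * L' x + p * L x = 0"
    and L_1: "L 1 = 1"

definition legendre_fn :: "real \<Rightarrow> real \<Rightarrow> real" where
  "legendre_fn p x = hg p ((1 - x) / 2)"

definition legendre_fn' :: "real \<Rightarrow> real \<Rightarrow> real" where
  "legendre_fn' p x = - hg' p ((1 - x) / 2) / 2"

definition legendre_fn'' :: "real \<Rightarrow> real \<Rightarrow> real" where
  "legendre_fn'' p x = hg'' p ((1 - x) / 2) / 4"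

lemma regular_legendre_exists:
  assumes p: "p = \<alpha> * (\<alpha> + 1)" "0 < p"
  shows "regular_legendre \<alpha> p (legendre_fn p) (legendre_fn' p) (legendre_fn'' p)"
proof
  fix x :: real
  assume "x \<in> {-1<..<3}"
  hence t: "\<bar>(1 - x) / 2\<bar> < 1" by auto
  have "((\<lambda>x. hg p ((1 - x) / 2)) has_real_derivative hg' p ((1 - x) / 2) * (- 1 / 2)) (at x)"
    by (rule DERIV_chain'[OF _ hg_deriv]) (use p t in \<open>auto intro!: derivative_eq_intros\<close>)
  thus "(legendre_fn p has_real_derivative legendre_fn' p x) (at x)"
    by (simp add: legendre_fn_def[abs_def] legendre_fn'_def)
  have "((\<lambda>x. hg' p ((1 - x) / 2)) has_real_derivative hg'' p ((1 - x) / 2) * (- 1 / 2)) (at x)"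
    by (rule DERIV_chain'[OF _ hg'_deriv]) (use p t in \<open>auto intro!: derivative_eq_intros\<close>)
  from DERIV_cdivide[OF DERIV_minus[OF this], of 2]
  show "(legendre_fn' p has_real_derivative legendre_fn'' p x) (at x)"
    by (simp add: legendre_fn'_def[abs_def] legendre_fn''_def)
next
  fix x :: real
  assume "x \<in> {-1<..<1}"
  hence t: "\<bar>(1 - x) / 2\<bar> < 1" by auto
  have "(1 - x\<^sup>2) * legendre_fn'' p x - 2 * x * legendre_fn' p x + p * legendre_fn p x =
     (1 - x) / 2 * (1 - (1 - x) / 2) * hg'' p ((1 - x) / 2) + (1 - 2 * ((1 - x) / 2)) * hg' p ((1 - x) / 2)
       + p * hg p ((1 - x) / 2)"
    by (simp add: legendre_fn_def legendre_fn'_def legendre_fn''_def power2_eq_square field_simps)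
  also have "\<dots> = 0" using p t by (intro hg_ode) auto
  finally show "(1 - x\<^sup>2) * legendre_fn'' p x - 2 * x * legendre_fn' p x + p * legendre_fn p x = 0" .
qed (use p in \<open>auto simp: legendre_fn_def hg_def\<close>)

context regular_legendre
begin

lemma L_solves: "legendre_ode_on p {-1<..<1} L L' L''"
  unfolding legendre_ode_on_def using L_deriv L'_deriv L_ode by auto

lemma L_isCont: "x \<in> {-1<..<3} \<Longrightarrow> isCont L x"
  using L_deriv DERIV_isCont by blast

lemma L_near_1: "\<exists>\<delta>>0. \<forall>x. \<bar>x - 1\<bar> < \<delta> \<longrightarrow> 1/2 < L x \<and> L x < 2"
proof -
  have "(L \<longlongrightarrow> 1) (at 1)" using L_isCont[of 1] L_1 by (simp add: isCont_def)
  hence "eventually (\<lambda>x. 1/2 < L x \<and> L x < 2) (at 1)"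
    by (intro eventually_conj order_tendstoD) auto
  then obtain \<delta> where \<delta>: "\<delta> > 0" "\<And>x. x \<noteq> 1 \<Longrightarrow> dist x 1 < \<delta> \<Longrightarrow> 1/2 < L x \<and> L x < 2"
    unfolding eventually_at by auto
  moreover have "1/2 < L x \<and> L x < 2" if "\<bar>x - 1\<bar> < \<delta>" for x
    using \<delta>(2)[of x] that L_1 by (cases "x = 1") (auto simp: dist_real_def)
  ultimately show ?thesis by blast
qed

lemma L_tendsto_left_1: "(L \<longlongrightarrow> 1) (at_left 1)"
  using L_isCont[of 1] L_1 by (simp add: isCont_def filterlim_at_split)

lemma legendre_sol_L: "legendre_sol \<alpha> L"
  unfolding legendre_sol_def
proof (intro conjI ballI)
  fix x :: real assume x: "x \<in> {-1<..<1}"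
  have deriv_eq: "deriv L u = L' u" if "u \<in> {-1<..<3}" for u
    using L_deriv[OF that] by (rule DERIV_imp_deriv)
  have "(deriv L has_real_derivative L'' x) (at x)"
    using x deriv_eq by (intro has_field_derivative_transform_within_open[OF L'_deriv, of x "{-1<..<3}"]) auto
  moreover from this have "deriv (deriv L) x = L'' x" by (rule DERIV_imp_deriv)
  moreover have "deriv L x = L' x" using x by (intro deriv_eq) auto
  ultimately show "(L has_real_derivative deriv L x) (at x)"
    and "(deriv L has_real_derivative deriv (deriv L) x) (at x)"
    and "(1 - x\<^sup>2) * deriv (deriv L) x - 2 * x * deriv L x + \<alpha> * (\<alpha> + 1) * L x = 0"
    using L_deriv[of x] L_ode[OF x] x by (auto simp: p_def)
next
  obtain \<delta> where \<delta>: "\<delta> > 0" "\<And>x. \<bar>x - 1\<bar> < \<delta> \<Longrightarrow> 1/2 < L x \<and> L x < 2"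
    using L_near_1 by blast
  have "\<bar>L x\<bar> \<le> 2" if "x \<in> {1 - \<delta><..<1}" for x
    using \<delta>(2)[of x] that by auto
  thus "\<exists>\<delta>>0. \<exists>B. \<forall>x\<in>{1 - \<delta><..<1}. \<bar>L x\<bar> \<le> B" using \<delta>(1) by blast
qed (fact L_tendsto_left_1 L_1)+

lemma legendre_sol_solves:
  "legendre_sol \<alpha> y \<Longrightarrow> legendre_ode_on p {-1<..<1} y (deriv y) (deriv (deriv y))"
  using legendre_sol_ode by (simp add: p_def)

lemma ratio_deriv:
  assumes y: "legendre_ode_on p {-1<..<1} y y' y''"
    and W: "\<And>u. u \<in> {-1<..<1} \<Longrightarrow> (1 - u\<^sup>2) * (L u * y' u - L' u * y u) = c"
    and x: "x \<in> {-1<..<1}" and "L x \<noteq> 0"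
  shows "((\<lambda>u. y u / L u) has_real_derivative c / ((1 - x\<^sup>2) * (L x)\<^sup>2)) (at x)"
proof -
  have "1 - x\<^sup>2 \<noteq> 0" using square_less_1_if_in_interval[OF x] by simp
  hence W_x: "L x * y' x - L' x * y x = c / (1 - x\<^sup>2)"
    using W[OF x] by (simp add: eq_divide_eq mult.commute)
  have "(y' x * L x - y x * L' x) / (L x * L x) = (L x * y' x - L' x * y x) / (L x)\<^sup>2"
    by (simp add: power2_eq_square mult.commute)
  also have "\<dots> = c / ((1 - x\<^sup>2) * (L x)\<^sup>2)" unfolding W_x by simp
  finally show ?thesis
    using DERIV_divide[OF legendre_ode_onD(1)[OF y x] L_deriv \<open>L x \<noteq> 0\<close>] x by simp
qed

text \<open>A solution bounded near 1 has vanishing Wronskian with L: otherwise the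
  ratio y/L would have derivative of size at least |c|/(8(1-x)) and blow up.\<close>
lemma wronskian_vanishes_if_bounded:
  assumes y: "legendre_ode_on p {-1<..<1} y y' y''"
    and bounded: "\<exists>\<delta>>0. \<exists>B. \<forall>x\<in>{1-\<delta><..<1}. \<bar>y x\<bar> \<le> B"
  shows "\<forall>x\<in>{-1<..<1}. (1 - x\<^sup>2) * (L x * y' x - L' x * y x) = 0"
proof -
  obtain c where c: "\<And>x. x \<in> {-1<..<1} \<Longrightarrow> (1 - x\<^sup>2) * (L x * y' x - L' x * y x) = c"
    using legendre_wronskian_constant[OF L_solves y] by blast
  obtain \<delta>1 B where B: "\<delta>1 > 0" "\<And>x. x \<in> {1-\<delta>1<..<1} \<Longrightarrow> \<bar>y x\<bar> \<le> B"
    using bounded by blast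
  obtain \<delta>2 where \<delta>2: "\<delta>2 > 0" "\<And>x. \<bar>x - 1\<bar> < \<delta>2 \<Longrightarrow> 1/2 < L x \<and> L x < 2"
    using L_near_1 by blast
  define a where "a = max 0 (1 - min \<delta>1 \<delta>2)"
  have "a < 1" using B(1) \<delta>2(1) by (simp add: a_def)
  have window: "x \<in> {-1<..<1} \<and> \<bar>y x\<bar> \<le> B \<and> 1/2 < L x \<and> L x < 2" if "a < x" "x < 1" for x
    using that B(2)[of x] \<delta>2(2)[of x] by (auto simp: a_def)
  define \<sigma> where "\<sigma> = sgn c"
  have "c = 0"
  proof (rule ccontr)
    assume "c \<noteq> 0"
    hence "0 < \<bar>c\<bar> / 8" by simp
    have "\<exists>x. a < x \<and> x < 1 \<and> 2 * B < \<sigma> * (y x / L x)"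
    proof (rule unbounded_if_deriv_ge_log_rate[OF \<open>a < 1\<close> \<open>0 < \<bar>c\<bar> / 8\<close>])
      fix x assume x: "a < x" "x < 1"
      have L_x: "1/2 < L x" "L x < 2" and x1: "x \<in> {-1<..<1}" using window[OF x] by auto
      show "((\<lambda>u. \<sigma> * (y u / L u)) has_real_derivative \<sigma> * (c / ((1 - x\<^sup>2) * (L x)\<^sup>2))) (at x)"
        using ratio_deriv[OF y c x1] L_x by (intro DERIV_cmult) auto
      have "0 < 1 - x\<^sup>2" using square_less_1_if_in_interval[OF x1] by simp
      moreover have "(1 - x\<^sup>2) * (L x)\<^sup>2 \<le> 8 * (1 - x)"
      proof -
        have "(L x)\<^sup>2 \<le> 4" using L_x power_mono[of "L x" 2 2] by simp
        moreover note one_minus_square_le[of x]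
        ultimately have "(1 - x\<^sup>2) * (L x)\<^sup>2 \<le> (2 * (1 - x)) * 4"
          using \<open>0 < 1 - x\<^sup>2\<close> by (intro mult_mono) auto
        thus ?thesis by simp
      qed
      ultimately have "\<bar>c\<bar> / (8 * (1 - x)) \<le> \<bar>c\<bar> / ((1 - x\<^sup>2) * (L x)\<^sup>2)"
        using L_x x by (intro divide_left_mono mult_pos_pos) auto
      thus "\<bar>c\<bar> / 8 / (1 - x) \<le> \<sigma> * (c / ((1 - x\<^sup>2) * (L x)\<^sup>2))"
        by (simp add: \<sigma>_def abs_sgn mult.commute)
    qed
    then obtain x where x: "a < x" "x < 1" and big: "2 * B < \<sigma> * (y x / L x)" by blast
    have "\<sigma> * (y x / L x) \<le> \<bar>y x\<bar> / L x"
      using window[OF x] by (auto simp: \<sigma>_def sgn_if abs_if divide_le_cancel)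
    also have "\<dots> \<le> 2 * B"
    proof -
      have "\<bar>y x\<bar> \<le> B" "1/2 < L x" using window[OF x] by auto
      moreover from this have "B * 1 \<le> B * (2 * L x)" by (intro mult_left_mono) auto
      ultimately show ?thesis by (simp add: divide_le_eq)
    qed
    finally show False using big by simp
  qed
  thus ?thesis using c by simp
qed

text \<open>A normalized bounded solution coincides with L near 1: its Wronskian with L
  vanishes, so y/L is locally constant there, and the constant is the limit 1.\<close>
lemma legendre_sol_agrees_near_1:
  assumes y: "legendre_sol \<alpha> y"
  shows "\<exists>a<1. \<forall>x\<in>{a<..<1}. y x = L x"
proof -
  note y_solves = legendre_sol_solves[OF y]
  have W0: "(1 - u\<^sup>2) * (L u * deriv y u - L' u * y u) = 0" if "u \<in> {-1<..<1}" for u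
    using wronskian_vanishes_if_bounded[OF y_solves legendre_solD(1)[OF y]] that by blast
  obtain \<delta> where \<delta>: "\<delta> > 0" "\<And>x. \<bar>x - 1\<bar> < \<delta> \<Longrightarrow> 1/2 < L x \<and> L x < 2"
    using L_near_1 by blast
  define a where "a = max 0 (1 - \<delta>)"
  have "a < 1" using \<delta>(1) by (simp add: a_def)
  have window: "x \<in> {-1<..<1} \<and> 1/2 < L x" if "x \<in> {a<..<1}" for x
    using that \<delta>(2)[of x] by (auto simp: a_def)
  obtain k where k: "\<And>x. x \<in> {a<..<1} \<Longrightarrow> y x / L x = k"
  proof -
    have "\<exists>k. \<forall>x\<in>{a<..<1}. y x / L x = k"
    proof (rule has_field_derivative_zero_constant)
      fix x assume "x \<in> {a<..<1}"
      with window[OF this] have "((\<lambda>u. y u / L u) has_real_derivative 0) (at x)"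
        using ratio_deriv[OF y_solves W0, of x] by simp
      thus "((\<lambda>u. y u / L u) has_real_derivative 0) (at x within {a<..<1})"
        by (rule has_field_derivative_at_within)
    qed simp
    thus ?thesis using that by blast
  qed
  have "((\<lambda>u. y u / L u) \<longlongrightarrow> 1) (at_left 1)"
    using tendsto_divide[OF legendre_solD(2)[OF y] L_tendsto_left_1] by simp
  moreover have "((\<lambda>u. y u / L u) \<longlongrightarrow> k) (at_left 1)"
  proof (rule tendsto_eventually)
    show "\<forall>\<^sub>F u in at_left 1. y u / L u = k"
      using eventually_at_left_real[OF \<open>a < 1\<close>] by eventually_elim (use k in auto)
  qed
  ultimately have "k = 1" by (rule tendsto_unique[OF trivial_limit_at_left_real, symmetric])
  have "y x = L x" if "x \<in> {a<..<1}" for x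
    using k[OF that] window[OF that] \<open>k = 1\<close> by (simp add: divide_eq_1_iff)
  thus ?thesis using \<open>a < 1\<close> by blast
qed

lemma legendre_sol_eq_L:
  assumes y: "legendre_sol \<alpha> y" and x: "x \<in> {-1<..1}"
  shows "y x = L x"
proof -
  obtain a where "a < 1" and near: "\<And>u. u \<in> {a<..<1} \<Longrightarrow> y u = L u"
    using legendre_sol_agrees_near_1[OF y] by blast
  define c where "c = (max a 0 + 1) / 2"
  have c: "a < c" "0 < c" "c < 1" using \<open>a < 1\<close> by (auto simp: c_def)
  have "(y has_real_derivative L' c) (at c)"
    using c near by (intro has_field_derivative_transform_within_open[OF L_deriv, of c "{a<..<1}"]) auto
  hence "deriv y c = L' c" by (rule DERIV_imp_deriv)
  consider "x \<le> c" | "c < x" "x < 1" | "x = 1" using x by force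
  thus ?thesis
  proof cases
    case 1
    have d: "legendre_ode_on p {-1<..<1} (\<lambda>u. y u - L u) (\<lambda>u. deriv y u - L' u)
        (\<lambda>u. deriv (deriv y) u - L'' u)"
      by (rule legendre_ode_on_diff[OF legendre_sol_solves[OF y] L_solves])
    have "y x - L x = 0"
      using legendre_ode_backward_unique[OF d p_pos, of x c] x 1 c near[of c] \<open>deriv y c = L' c\<close>
      by auto
    thus ?thesis by simp
  next
    case 2 thus ?thesis using near c by auto
  next
    case 3 thus ?thesis using legendre_solD(3)[OF y] L_1 by simp
  qed
qed

lemma Leg_eq:
  assumes "x \<in> {-1<..1}" shows "Leg \<alpha> x = L x"
  unfolding Leg_def
proof (rule the_equality)
  show "\<exists>y. legendre_sol \<alpha> y \<and> y x = L x" using legendre_sol_L by blast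
  show "v = L x" if "\<exists>y. legendre_sol \<alpha> y \<and> y x = v" for v
    using that legendre_sol_eq_L[OF _ assms] by blast
qed

lemma Leg_deriv: "x \<in> {-1<..<1} \<Longrightarrow> (Leg \<alpha> has_real_derivative L' x) (at x)"
  by (rule has_field_derivative_transform_within_open[OF L_deriv, of x "{-1<..<1}"])
    (auto simp: Leg_eq)

text \<open>The flux (1 - x^2) L'; by the equation its derivative is -p L.\<close>
definition flux :: "real \<Rightarrow> real" where
  "flux x = (1 - x\<^sup>2) * L' x"

lemma flux_deriv: "x \<in> {-1<..<3} \<Longrightarrow> (flux has_real_derivative - (2 * x) * L' x + (1 - x\<^sup>2) * L'' x) (at x)"
  unfolding flux_def[abs_def] by (rule derivative_eq_intros L'_deriv refl | simp)+

lemma flux_strict_decreasing: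
  assumes "-1 < a" "a < b" "b \<le> 1" and L_pos: "\<And>u. a < u \<Longrightarrow> u < b \<Longrightarrow> 0 < L u"
  shows "flux b < flux a"
proof (rule DERIV_neg_imp_decreasing_open[OF \<open>a < b\<close>])
  fix u assume u: "a < u" "u < b"
  hence "u \<in> {-1<..<1}" using assms by auto
  hence "- (2 * u) * L' u + (1 - u\<^sup>2) * L'' u = - p * L u" using L_ode[of u] by simp
  also have "\<dots> < 0" using p_pos L_pos[OF u] by simp
  finally show "\<exists>y. (flux has_real_derivative y) (at u) \<and> y < 0"
    using flux_deriv[of u] u assms by auto
next
  show "continuous_on {a..b} flux"
    by (rule DERIV_continuous_on, rule has_field_derivative_at_within, rule flux_deriv)
      (use assms in auto)
qed

text \<open>Where L is positive up to 1, the flux, hence L', is positive.\<close>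
lemma L'_pos:
  assumes x: "x \<in> {-1<..<1}" and L_pos: "\<And>u. x < u \<Longrightarrow> u < 1 \<Longrightarrow> 0 < L u"
  shows "0 < L' x"
proof -
  have "0 < flux x" using flux_strict_decreasing[of x 1] x L_pos by (simp add: flux_def)
  thus ?thesis using square_less_1_if_in_interval[OF x] by (simp add: flux_def zero_less_mult_iff)
qed

text \<open>L(1) = 1 and the intermediate value theorem: without zeros on [x,1), L is positive there.\<close>
lemma L_pos_if_no_zero:
  assumes x: "x \<in> {-1<..<1}" and no_zero: "\<And>z. x \<le> z \<Longrightarrow> z < 1 \<Longrightarrow> L z \<noteq> 0"
  shows "0 < L x"
proof (rule ccontr)
  assume "\<not> 0 < L x"
  moreover have "continuous_on {x..1} L"
    using x by (intro continuous_at_imp_continuous_on ballI L_isCont) auto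
  ultimately obtain z where "x \<le> z" "z \<le> 1" "L z = 0"
    using IVT'[of L x 0 1] L_1 x by auto
  thus False using no_zero L_1 by (cases "z = 1") auto
qed

text \<open>L must vanish somewhere in (-1,1): otherwise the flux argument shows
  L'(x) \<ge> c/(1+x) near -1, so L would tend to -\<infinity> at -1.\<close>
lemma L_has_zero: "\<exists>z\<in>{-1<..<1}. L z = 0"
proof (rule ccontr)
  assume "\<not> ?thesis"
  hence L_pos: "0 < L x" if "x \<in> {-1<..<1}" for x
    using that L_pos_if_no_zero by force
  have "0 < flux 0" using flux_strict_decreasing[of 0 1] L_pos by (simp add: flux_def)
  have "\<exists>u. 0 < u \<and> u < 1 \<and> 0 < - L (- u)"
  proof (rule unbounded_if_deriv_ge_log_rate)
    show "0 < flux 0 / 2" using \<open>0 < flux 0\<close> by simp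
    fix u :: real assume u: "0 < u" "u < 1"
    show "((\<lambda>u. - L (- u)) has_real_derivative L' (- u)) (at u)"
      using u by (auto intro!: derivative_eq_intros DERIV_chain'[OF _ L_deriv])
    have "0 < 1 - u\<^sup>2" using u by (simp add: power_less_one_iff)
    have "flux 0 / 2 / (1 - u) = flux 0 / (2 * (1 - u))" by simp
    also have "\<dots> \<le> flux 0 / (1 - u\<^sup>2)"
      using \<open>0 < 1 - u\<^sup>2\<close> one_minus_square_le[of u] \<open>0 < flux 0\<close> by (intro divide_left_mono) auto
    also have "\<dots> \<le> flux (- u) / (1 - u\<^sup>2)"
      using flux_strict_decreasing[of "- u" 0] L_pos u \<open>0 < 1 - u\<^sup>2\<close> by (intro divide_right_mono) auto
    also have "\<dots> = L' (- u)" using \<open>0 < 1 - u\<^sup>2\<close> by (simp add: flux_def)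
    finally show "flux 0 / 2 / (1 - u) \<le> L' (- u)" .
  qed simp
  then obtain u where "0 < u" "u < 1" "L (- u) < 0" by auto
  thus False using L_pos[of "- u"] by simp
qed

text \<open>The zero set of L is closed, so L has a largest zero in (-1,1).\<close>
lemma L_largest_zero: "\<exists>s\<in>{-1<..<1}. L s = 0 \<and> (\<forall>x\<in>{-1<..<1}. L x = 0 \<longrightarrow> x \<le> s)"
proof -
  obtain z where z: "z \<in> {-1<..<1}" "L z = 0" using L_has_zero by blast
  define S where "S = {x \<in> {z..1}. L x = 0}"
  have "closed S" unfolding S_def
    using z by (intro continuous_closed_preimage_constant continuous_at_imp_continuous_on ballI L_isCont) auto
  moreover have "z \<in> S" using z by (simp add: S_def)
  moreover have "bdd_above S" by (auto simp: S_def bdd_above_def)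
  ultimately have "Sup S \<in> S" by (intro closed_contains_Sup) auto
  hence "L (Sup S) = 0" "z \<le> Sup S" "Sup S < 1" using L_1 by (auto simp: S_def less_le)
  moreover have "x \<le> Sup S" if "x \<in> {-1<..<1}" "L x = 0" for x
  proof (cases "z \<le> x")
    case True thus ?thesis using that \<open>bdd_above S\<close> by (auto simp: S_def intro: cSup_upper)
  qed (use \<open>z \<le> Sup S\<close> in simp)
  ultimately show ?thesis using z by (intro bexI[of _ "Sup S"]) auto
qed

lemma zp_props:
  shows "zp \<alpha> \<in> {-1<..<1}" and "\<And>x. zp \<alpha> < x \<Longrightarrow> x < 1 \<Longrightarrow> 0 < L x"
proof -
  obtain s where s: "s \<in> {-1<..<1}" "L s = 0" and largest: "\<And>x. x \<in> {-1<..<1} \<Longrightarrow> L x = 0 \<Longrightarrow> x \<le> s"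
    using L_largest_zero by blast
  have "zp \<alpha> = s" unfolding zp_def
  proof (rule Greatest_equality)
    show "s \<in> {-1<..<1} \<and> Leg \<alpha> s = 0" using s Leg_eq[of s] by auto
    show "x \<le> s" if "x \<in> {-1<..<1} \<and> Leg \<alpha> x = 0" for x
      using that largest Leg_eq[of x] by auto
  qed
  thus "zp \<alpha> \<in> {-1<..<1}" using s by simp
  show "0 < L x" if "zp \<alpha> < x" "x < 1" for x
  proof (rule L_pos_if_no_zero)
    show "x \<in> {-1<..<1}" using that s \<open>zp \<alpha> = s\<close> by auto
    show "L z \<noteq> 0" if "x \<le> z" "z < 1" for z
      using largest[of z] that \<open>zp \<alpha> < x\<close> \<open>zp \<alpha> = s\<close> s by force
  qed
qed

definition second_flux :: "real \<Rightarrow> real" where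
  "second_flux x = (1 - x\<^sup>2) * (2 * x * L' x - p * L x)"

lemma second_flux_eq: "x \<in> {-1<..<1} \<Longrightarrow> second_flux x = (1 - x\<^sup>2) * ((1 - x\<^sup>2) * L'' x)"
  using L_ode[of x] by (simp add: second_flux_def)

lemma second_flux_deriv:
  assumes "x \<in> {-1<..<1}"
  shows "(second_flux has_real_derivative (2 - p) * (1 - x\<^sup>2) * L' x) (at x)"
proof -
  have x3: "x \<in> {-1<..<3}" using assms by auto
  have raw: "(second_flux has_real_derivative
      - (2 * x) * (2 * x * L' x - p * L x) + (1 - x\<^sup>2) * (2 * L' x + 2 * x * L'' x - p * L' x)) (at x)"
    unfolding second_flux_def[abs_def]
    by (auto intro!: derivative_eq_intros L_deriv[OF x3] L'_deriv[OF x3] simp: algebra_simps)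
  have ode: "(1 - x\<^sup>2) * L'' x = 2 * x * L' x - p * L x" using L_ode[OF assms] by simp
  have "- (2 * x) * (2 * x * L' x - p * L x) + (1 - x\<^sup>2) * (2 * L' x + 2 * x * L'' x - p * L' x)
      = - (2 * x) * (2 * x * L' x - p * L x) + (2 - p) * (1 - x\<^sup>2) * L' x + 2 * x * ((1 - x\<^sup>2) * L'' x)"
    by (simp add: algebra_simps)
  also have "\<dots> = (2 - p) * (1 - x\<^sup>2) * L' x" unfolding ode by (simp add: algebra_simps)
  finally show ?thesis using raw by simp
qed

lemma second_flux_continuous: "continuous_on {-1<..1} second_flux"
  unfolding second_flux_def
  by (intro continuous_intros continuous_at_imp_continuous_on ballI L_isCont
      DERIV_isCont[OF L'_deriv]) auto

lemma L''_pos: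
  assumes "2 < p" and x: "zp \<alpha> < x" "x < 1"
  shows "0 < L'' x"
proof -
  have x1: "x \<in> {-1<..<1}" using x zp_props(1) by auto
  have "second_flux 1 < second_flux x"
  proof (rule DERIV_neg_imp_decreasing_open[OF \<open>x < 1\<close>])
    fix u assume u: "x < u" "u < 1"
    hence u1: "u \<in> {-1<..<1}" using x1 by auto
    have "0 < L' u" using L'_pos[OF u1] zp_props(2) u x by auto
    hence "(2 - p) * (1 - u\<^sup>2) * L' u < 0"
      using \<open>2 < p\<close> square_less_1_if_in_interval[OF u1] by (simp add: mult_neg_pos)
    thus "\<exists>y. (second_flux has_real_derivative y) (at u) \<and> y < 0"
      using second_flux_deriv[OF u1] by blast
  qed (use second_flux_continuous x1 in \<open>auto intro: continuous_on_subset\<close>)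
  moreover have "second_flux 1 = 0" by (simp add: second_flux_def)
  ultimately have "0 < (1 - x\<^sup>2) * ((1 - x\<^sup>2) * L'' x)"
    using second_flux_eq[OF x1] by simp
  thus ?thesis using square_less_1_if_in_interval[OF x1] by (simp add: zero_less_mult_iff)
qed

lemma L'_strict_mono:
  assumes "2 < p" shows "strict_mono_on {zp \<alpha>..<1} L'"
proof (rule strict_mono_onI)
  fix u v assume uv: "u \<in> {zp \<alpha>..<1}" "v \<in> {zp \<alpha>..<1}" "u < v"
  show "L' u < L' v"
  proof (rule DERIV_pos_imp_increasing_open[OF \<open>u < v\<close>])
    show "\<exists>y. (L' has_real_derivative y) (at t) \<and> 0 < y" if "u < t" "t < v" for t
      using L'_deriv[of t] L''_pos[OF assms, of t] that uv zp_props(1) by auto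
    show "continuous_on {u..v} L'"
      by (rule DERIV_continuous_on, rule has_field_derivative_at_within, rule L'_deriv)
        (use uv zp_props(1) in auto)
  qed
qed

end

theorem lemma7p2:
  fixes \<alpha> :: real
  assumes "\<alpha> > 0" and "\<alpha> * (\<alpha> + 1) > 2"
  shows "strict_convex_on {zp \<alpha>..<1} (Leg \<alpha>)"
proof -
  define p where p_eq: "p = \<alpha> * (\<alpha> + 1)"
  interpret regular_legendre \<alpha> p "legendre_fn p" "legendre_fn' p" "legendre_fn'' p"
    by (rule regular_legendre_exists) (use assms in \<open>auto simp: p_eq\<close>)
  show ?thesis
  proof (rule strict_convex_on_if_deriv_strict_mono)
    show "convex {zp \<alpha>..<1}" by simp
    show "(Leg \<alpha> has_real_derivative legendre_fn' p x) (at x)" if "x \<in> {zp \<alpha>..<1}" for x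
      using Leg_deriv zp_props(1) that by auto
    show "strict_mono_on {zp \<alpha>..<1} (legendre_fn' p)"
      using L'_strict_mono assms(2) by (simp add: p_eq)
  qed
qed

end
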